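(* Let $G$ be a connected graph of order at least $2$. If $S$ is a secure dominating set of $G$, then $$S_p = S \cup \operatorname{epn}(w,S\cup\{w\}) \cup \{w\}$$ is a secure dominating set of $\mu(G)$, where $\operatorname{epn}(w,S\cup\{w\})$ is the set of external private neighbors of $w$ with respect to $S\cup\{w\}$ in the graph $\mu(G)$.
   Context: All graphs are finite, simple, undirected, with nonempty vertex set; the order of a graph is its number of vertices. A set $S\subseteq V(G)$ is a dominating set of $G$ if every vertex of $V(G)\setminus S$ is adjacent to some vertex of $S$. A dominating set $S$ is a secure dominating set of $G$ if for every $u\in V(G)\setminus S$ there is $v\in S$ adjacent to $u$ such that $(S\setminus\{v\})\cup\{u\}$ is a dominating set of $G$. For a graph $G$ with vertices $v_1,\dots,v_n$, the Mycielskian $\mu(G)$ is the graph with vertex set $\{v_1,\dots,v_n,u_1,\dots,u_n,w\}$ ($2n+1$ distinct vertices) whose edges are: all edges of $G$; the edges $wu_i$ for $1\le i\le n$; and, for each edge $v_iv_j$ of $G$, the edges $u_iv_j$ and $v_iu_j$. Subsets of $V(G)$ are regarded as subsets of $V(\mu(G))$. For a graph $H$, a set $T\subseteq V(H)$ and $x\in T$, the set of external private neighbors $\operatorname{epn}(x,T)$ consists of the vertices $c\in V(H)\setminus T$ that are adjacent to $x$ and to no other vertex of $T$. *)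

theory Defs
  imports "Graph_Theory.Graph_Theory"
begin

text \<open>
  Finite simple undirected graphs are the \<^locale>\<open>pair_graph\<close> structures of Graph_Theory: finite,
  loop-free symmetric digraphs without parallel arcs. An edge \<open>xy\<close> is represented by the two arcs
  \<open>(x, y)\<close> and \<open>(y, x)\<close>.
\<close>

definition dominating_set :: "'a pair_pre_digraph \<Rightarrow> 'a set \<Rightarrow> bool" where
  "dominating_set G S \<longleftrightarrow>
     S \<subseteq> pverts G \<and> (\<forall>u \<in> pverts G - S. \<exists>v \<in> S. (u, v) \<in> parcs G)"

definition secure_dominating_set :: "'a pair_pre_digraph \<Rightarrow> 'a set \<Rightarrow> bool" where
  "secure_dominating_set G S \<longleftrightarrow>
     dominating_set G S \<and>
     (\<forall>u \<in> pverts G - S. \<exists>v \<in> S. (u, v) \<in> parcs G \<and> dominating_set G ((S - {v}) \<union> {u}))"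

definition epn :: "'a pair_pre_digraph \<Rightarrow> 'a \<Rightarrow> 'a set \<Rightarrow> 'a set" where
  "epn G x T =
     {c \<in> pverts G - T. (c, x) \<in> parcs G \<and> (\<forall>y \<in> T. (c, y) \<in> parcs G \<longrightarrow> y = x)}"

text \<open>
  The vertices \<open>v\<^sub>i\<close>, \<open>u\<^sub>i\<close> and \<open>w\<close> of the Mycielskian are \<open>Orig v\<^sub>i\<close>, \<open>Copy v\<^sub>i\<close> and \<open>Root\<close>;
  a subset \<open>S\<close> of the vertices of \<open>G\<close>, regarded as a subset of the vertices of the Mycielskian, is
  the image \<open>Orig ` S\<close>.
\<close>

datatype 'a myc_vertex = Orig 'a | Copy 'a | Root

definition mycielskian :: "'a pair_pre_digraph \<Rightarrow> 'a myc_vertex pair_pre_digraph" where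
  "mycielskian G =
     \<lparr> pverts = Orig ` pverts G \<union> Copy ` pverts G \<union> {Root},
       parcs = {(Orig x, Orig y) | x y. (x, y) \<in> parcs G}
         \<union> {(Root, Copy x) | x. x \<in> pverts G} \<union> {(Copy x, Root) | x. x \<in> pverts G}
         \<union> {(Copy x, Orig y) | x y. (x, y) \<in> parcs G}
         \<union> {(Orig x, Copy y) | x y. (x, y) \<in> parcs G} \<rparr>"

lemma card_pverts_mycielskian:
  assumes "finite (pverts G)"
  shows "card (pverts (mycielskian G)) = 2 * card (pverts G) + 1"
proof -
  have "card (Orig ` pverts G \<union> Copy ` pverts G) = card (pverts G) + card (pverts G)"
    using assms by (subst card_Un_disjoint) (auto simp: card_image inj_on_def)
  moreover have "Root \<notin> Orig ` pverts G \<union> Copy ` pverts G" by auto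
  ultimately show ?thesis
    using assms by (simp add: mycielskian_def)
qed

lemma pair_graph_mycielskian:
  assumes "pair_graph G"
  shows "pair_graph (mycielskian G)"
proof -
  interpret pair_graph G by fact
  have symG: "(y, x) \<in> parcs G" if "(x, y) \<in> parcs G" for x y
    using pair_sym_arcs that by (auto simp: symmetric_def sym_def)
  have V: "finite (pverts (mycielskian G))"
    by (simp add: mycielskian_def pair_finite_verts)
  have sub: "parcs (mycielskian G) \<subseteq> pverts (mycielskian G) \<times> pverts (mycielskian G)"
    by (auto simp: mycielskian_def dest: in_arcsD1 in_arcsD2)
  show ?thesis
  proof
    show "finite (parcs (mycielskian G))"
      using sub V by (meson finite_SigmaI finite_subset)
    show "symmetric (with_proj (mycielskian G))"
      by (auto simp: symmetric_def sym_def mycielskian_def dest: symG)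
    show "fst e \<noteq> snd e" if "e \<in> parcs (mycielskian G)" for e
      using that pair_no_loops by (fastforce simp: mycielskian_def)
  qed (use V sub in auto)
qed

end

theory Submission
  imports Defs
begin

text \<open>
  The neighbours of \<open>Root\<close> are the copies, and a copy has the same original neighbours as the vertex
  it copies. So the external private neighbours added to \<open>S\<close> are the copies of those vertices
  that have no neighbour in \<open>S\<close>, and every copy left outside the new set \<open>S\<^sub>p\<close> is dominated twice:
  by \<open>Root\<close> and by an original in \<open>S\<close>.

  This settles how an attack on each kind of vertex is answered. An attacked original \<open>Orig x\<close> is
  defended as in \<open>G\<close>: the originals stay dominated because the exchange works in \<open>G\<close>,
  and the copies by \<open>Root\<close>, which does not move. An attacked copy is defended by \<open>Root\<close>:
  the originals in \<open>S\<close> stay in place and dominate all originals and all copies outside \<open>S\<^sub>p\<close>, while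
  \<open>Root\<close> is now dominated by the attacked copy.
\<close>

lemma mem_parcs_mycielskian:
  "(Orig x, Orig y) \<in> parcs (mycielskian G) \<longleftrightarrow> (x, y) \<in> parcs G"
  "(Copy x, Orig y) \<in> parcs (mycielskian G) \<longleftrightarrow> (x, y) \<in> parcs G"
  "(Copy x, Root) \<in> parcs (mycielskian G) \<longleftrightarrow> x \<in> pverts G"
  "(Root, Copy x) \<in> parcs (mycielskian G) \<longleftrightarrow> x \<in> pverts G"
  by (auto simp: mycielskian_def)

lemma mem_pverts_mycielskian:
  "Orig x \<in> pverts (mycielskian G) \<longleftrightarrow> x \<in> pverts G"
  "Copy x \<in> pverts (mycielskian G) \<longleftrightarrow> x \<in> pverts G"
  "Root \<in> pverts (mycielskian G)"
  by (auto simp: mycielskian_def)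

lemma Copy_mem_epn_Root_iff:
  "Copy x \<in> epn (mycielskian G) Root (Orig ` S \<union> {Root}) \<longleftrightarrow>
     x \<in> pverts G \<and> (\<forall>y \<in> S. (x, y) \<notin> parcs G)"
  by (auto simp: epn_def mem_pverts_mycielskian mem_parcs_mycielskian)

lemma dominating_set_mycielskian_Root:
  assumes "dominating_set G S" "Orig ` S \<union> {Root} \<subseteq> T" "T \<subseteq> pverts (mycielskian G)"
  shows "dominating_set (mycielskian G) T"
  unfolding dominating_set_def
proof (intro conjI ballI)
  fix u assume u: "u \<in> pverts (mycielskian G) - T"
  show "\<exists>v \<in> T. (u, v) \<in> parcs (mycielskian G)"
  proof (cases u)
    case (Orig x)
    then have "x \<in> pverts G - S"
      using u assms(2) by (auto simp: mem_pverts_mycielskian)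
    then obtain y where "y \<in> S" "(x, y) \<in> parcs G"
      using assms(1) by (auto simp: dominating_set_def)
    then show ?thesis
      using Orig assms(2) by (auto simp: mem_parcs_mycielskian intro!: bexI[of _ "Orig y"])
  next
    case (Copy x)
    then show ?thesis
      using u assms(2)
      by (auto simp: mem_pverts_mycielskian mem_parcs_mycielskian intro!: bexI[of _ Root])
  next
    case Root
    then show ?thesis using u assms(2) by auto
  qed
qed (fact assms(3))

text \<open>
  The two tasks of \<open>Root\<close> are shared out when it is absent: any single copy in \<open>T\<close> dominates
  \<open>Root\<close>, and the originals in \<open>S\<close> dominate the copies outside \<open>T\<close>.
\<close>

lemma dominating_set_mycielskian_Copy:
  assumes "dominating_set G S" "Orig ` S \<subseteq> T" "T \<subseteq> pverts (mycielskian G)" "Copy c \<in> T"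
    and reach: "\<And>x. x \<in> pverts G \<Longrightarrow> Copy x \<notin> T \<Longrightarrow> \<exists>y \<in> S. (x, y) \<in> parcs G"
  shows "dominating_set (mycielskian G) T"
  unfolding dominating_set_def
proof (intro conjI ballI)
  fix u assume u: "u \<in> pverts (mycielskian G) - T"
  show "\<exists>v \<in> T. (u, v) \<in> parcs (mycielskian G)"
  proof (cases u)
    case (Orig x)
    then have "x \<in> pverts G - S"
      using u assms(2) by (auto simp: mem_pverts_mycielskian)
    then obtain y where "y \<in> S" "(x, y) \<in> parcs G"
      using assms(1) by (auto simp: dominating_set_def)
    then show ?thesis
      using Orig assms(2) by (auto simp: mem_parcs_mycielskian intro!: bexI[of _ "Orig y"])
  next
    case (Copy x)
    then obtain y where "y \<in> S" "(x, y) \<in> parcs G"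
      using u reach by (auto simp: mem_pverts_mycielskian)
    then show ?thesis
      using Copy assms(2) by (auto simp: mem_parcs_mycielskian intro!: bexI[of _ "Orig y"])
  next
    case Root
    have "c \<in> pverts G"
      using assms(3,4) by (auto simp: mem_pverts_mycielskian dest!: subsetD)
    then show ?thesis
      using Root assms(4) by (auto simp: mem_parcs_mycielskian intro!: bexI[of _ "Copy c"])
  qed
qed (fact assms(3))

theorem proposition2p4:
  fixes G :: "'a pair_pre_digraph" and S :: "'a set"
  assumes "pair_graph G"
    and "Digraph_Component.connected (with_proj G)"
    and "card (pverts G) \<ge> 2"
    and "secure_dominating_set G S"
  shows "secure_dominating_set (mycielskian G)
           (Orig ` S \<union> epn (mycielskian G) Root (Orig ` S \<union> {Root}) \<union> {Root})"
proof -
  let ?M = "mycielskian G"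
  let ?P = "epn ?M Root (Orig ` S \<union> {Root})"
  let ?T = "Orig ` S \<union> ?P \<union> {Root}"
  have dom: "dominating_set G S"
    using assms(4) by (simp add: secure_dominating_set_def)
  then have S: "S \<subseteq> pverts G"
    by (simp add: dominating_set_def)
  have T: "?T \<subseteq> pverts ?M"
    using S by (auto simp: mem_pverts_mycielskian epn_def)
  show ?thesis
    unfolding secure_dominating_set_def
  proof (intro conjI ballI)
    show "dominating_set ?M ?T"
      using dom T by (intro dominating_set_mycielskian_Root[of G S]) auto
    fix u assume u: "u \<in> pverts ?M - ?T"
    show "\<exists>v \<in> ?T. (u, v) \<in> parcs ?M \<and> dominating_set ?M ((?T - {v}) \<union> {u})"
    proof (cases u)
      case (Orig x)
      then have "x \<in> pverts G - S"
        using u by (auto simp: mem_pverts_mycielskian)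
      then obtain y where y: "y \<in> S" "(x, y) \<in> parcs G" "dominating_set G ((S - {y}) \<union> {x})"
        using assms(4) unfolding secure_dominating_set_def by blast
      have "dominating_set ?M ((?T - {Orig y}) \<union> {u})"
        using T u Orig by (intro dominating_set_mycielskian_Root[OF y(3)]) auto
      then show ?thesis
        using y(1,2) Orig by (intro bexI[of _ "Orig y"]) (auto simp: mem_parcs_mycielskian)
    next
      case (Copy x)
      then have x: "x \<in> pverts G"
        using u by (simp add: mem_pverts_mycielskian)
      have "dominating_set ?M ((?T - {Root}) \<union> {u})"
      proof (rule dominating_set_mycielskian_Copy[OF dom])
        show "(?T - {Root}) \<union> {u} \<subseteq> pverts ?M"
          using T u by auto
        show "\<exists>y \<in> S. (z, y) \<in> parcs G"
          if "z \<in> pverts G" "Copy z \<notin> (?T - {Root}) \<union> {u}" for z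
          using that Copy_mem_epn_Root_iff[of z G S] by auto
      qed (use Copy in auto)
      then show ?thesis
        using Copy x by (intro bexI[of _ Root]) (auto simp: mem_parcs_mycielskian)
    next
      case Root
      then show ?thesis using u by auto
    qed
  qed
qed

end
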